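(* Consider the additive noise latent causal model described in the context in which, for each $i\in[n]$, $f_{p,i}$ and $f_{q,i}$ are two-layer neural networks $$f_{p,i}(\varphi)=\sum_{j=1}^{w_{p,i}}\nu^{p,i}_j\,\sigma(W^{p,i}_j\varphi)+\nu^{p,i}_0,\qquad f_{q,i}(\varphi)=\sum_{j=1}^{w_{q,i}}\nu^{q,i}_j\,\sigma(W^{q,i}_j\varphi)+\nu^{q,i}_0 ,\qquad \varphi\in\mathbb R^{|\mathrm{pa}(i)|},$$ where $\sigma$ is the sigmoid function, $W^{p,i}\in\mathbb R^{w_{p,i}\times|\mathrm{pa}(i)|}$ and $W^{q,i}\in\mathbb R^{w_{q,i}\times|\mathrm{pa}(i)|}$ have $j$-th rows $W^{p,i}_j$, $W^{q,i}_j$, $\nu^{p,i}\in\mathbb R^{w_{p,i}}$, $\nu^{q,i}\in\mathbb R^{w_{q,i}}$, and $\nu_0^{p,i},\nu_0^{q,i}\in\mathbb R$. If for all $i\in[n]$ $$\max\{\mathrm{rank}(W^{p,i}),\ \mathrm{rank}(W^{q,i})\}=|\mathrm{pa}(i)|,$$ then for every $i\in[n]$ and every $c\in\mathcal C_i$, it is not the case that $c^\top s_Z(Z)=c^\top s_Z^{m_i}(Z)$ almost surely under $Z\sim p_Z$.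
   Context: $Z=(Z_1,\dots,Z_n)^\top$ is a random vector with density $p_Z$ on $\mathbb R^n$, $p_Z(z)\ne0$ for all $z$, factorizing along a DAG on $[n]=\{1,\dots,n\}$: $p_Z(z)=\prod_i p_Z(z_i\mid z_{\mathrm{pa}(i)})$, where $\mathrm{pa}(i)$ is the set of parents of $i$ and $\overline{\mathrm{pa}}(i)=\mathrm{pa}(i)\cup\{i\}$. For each $i$ there is an interventional conditional density $q_Z(z_i\mid z_{\mathrm{pa}(i)})$ different from $p_Z(z_i\mid z_{\mathrm{pa}(i)})$. All conditional densities are positive and continuously differentiable in all variables. Additive noise model: the observational and interventional mechanisms of node $i$ are $Z_i=f_{p,i}(Z_{\mathrm{pa}(i)})+N_{p,i}$ and $Z_i=f_{q,i}(Z_{\mathrm{pa}(i)})+N_{q,i}$, with noise terms independent of $Z_{\mathrm{pa}(i)}$ whose pdfs are analytic; i.e. $p_Z(z_i\mid z_{\mathrm{pa}(i)})=h_{p,i}(z_i-f_{p,i}(z_{\mathrm{pa}(i)}))$ and $q_Z(z_i\mid z_{\mathrm{pa}(i)})=h_{q,i}(z_i-f_{q,i}(z_{\mathrm{pa}(i)}))$, with $h_{p,i},h_{q,i}$ the noise pdfs. The sigmoid function is $\sigma(x)=1/(1+e^{-x})$. Environments: each node $i$ is intervened in exactly one environment $m_i$, in which only node $i$ is intervened; the latent density there is $p^{m_i}(z)=q_Z(z_i\mid z_{\mathrm{pa}(i)})\prod_{j\neq i}p_Z(z_j\mid z_{\mathrm{pa}(j)})$. Scores: $s_Z=\nabla_z\log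 p_Z$, $s_Z^{m_i}=\nabla_z\log p^{m_i}$. $\mathcal C_i=\{c\in\mathbb R^n:\exists j\in\overline{\mathrm{pa}}(i)\text{ such that }c_j\ne0\}$.
   Formalization: Added: for each i some network with rank |pa(i)| has no cancelling hidden units (after merging units whose rows agree up to sign, none with nonzero row has output weight 0). Otherwise false: pa(2)={1}, W^{p,2}=(1), ν^{p,2}=0, f_{q,2}=0, Gaussian noises of different variance, c=e_1. *)

theory Defs
  imports "HOL-Probability.Probability"
begin

text \<open>
  The nodes form the finite index type \<open>'n\<close>, latent vectors have type \<open>real ^ 'n\<close>, and
  \<open>pa i\<close> is the set of parents of \<open>i\<close>.  A conditional density of
  coordinate \<open>i\<close> given the coordinates in \<open>pa i\<close> is represented by a function of the whole vector.
\<close>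

definition acyclic_parents :: "('n \<Rightarrow> 'n set) \<Rightarrow> bool" where
  "acyclic_parents pa \<longleftrightarrow> acyclic {(j, i). j \<in> pa i}"

definition real_analytic :: "(real \<Rightarrow> real) \<Rightarrow> bool" where
  "real_analytic h \<longleftrightarrow>
     (\<forall>x. \<exists>a. \<exists>r>0. \<forall>y. \<bar>y - x\<bar> < r \<longrightarrow> (\<lambda>k. a k * (y - x) ^ k) sums h y)"

definition analytic_pdf :: "(real \<Rightarrow> real) \<Rightarrow> bool" where
  "analytic_pdf h \<longleftrightarrow>
     real_analytic h \<and> (\<forall>x. 0 \<le> h x) \<and> integrable lborel h \<and> (LINT x|lborel. h x) = 1"

definition cont_differentiable :: "(real ^ 'n::finite \<Rightarrow> real) \<Rightarrow> bool" where
  "cont_differentiable g \<longleftrightarrow> (\<exists>D. (\<forall>z. GDERIV g z :> D z) \<and> continuous_on UNIV D)"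

definition sigmoid :: "real \<Rightarrow> real" where
  "sigmoid x = 1 / (1 + exp (- x))"

text \<open>
  A two-layer network on \<open>\<real>\<^sup>S\<close> with \<open>w\<close> hidden units has the weight matrix \<open>W j k\<close>, where
  \<open>j < w\<close> and \<open>k \<in> S\<close>; entries of \<open>W\<close> outside this range are ignored.  Its rows are regarded as
  vectors of the coordinate subspace \<open>\<real>\<^sup>S\<close> of \<open>real ^ 'n\<close>.
\<close>

definition two_layer ::
  "'n::finite set \<Rightarrow> nat \<Rightarrow> (nat \<Rightarrow> 'n \<Rightarrow> real) \<Rightarrow> (nat \<Rightarrow> real) \<Rightarrow> real \<Rightarrow> real ^ 'n \<Rightarrow> real" where
  "two_layer S w W \<nu> \<nu>0 z = (\<Sum>j<w. \<nu> j * sigmoid (\<Sum>k\<in>S. W j k * z $ k)) + \<nu>0"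

definition weight_row :: "'n::finite set \<Rightarrow> (nat \<Rightarrow> 'n \<Rightarrow> real) \<Rightarrow> nat \<Rightarrow> real ^ 'n" where
  "weight_row S W j = (\<chi> k. if k \<in> S then W j k else 0)"

definition weight_rank :: "'n::finite set \<Rightarrow> nat \<Rightarrow> (nat \<Rightarrow> 'n \<Rightarrow> real) \<Rightarrow> nat" where
  "weight_rank S w W = dim (weight_row S W ` {..<w})"

text \<open>
  Since \<open>sigmoid (- x) = 1 - sigmoid x\<close>, all hidden units with weight row \<open>u\<close> or \<open>- u\<close> together
  contribute \<open>merged_weight S w W \<nu> u * sigmoid (u \<bullet> z)\<close> plus a constant.  In a network without
  cancelling units none of these merged units vanishes, except for those with zero weight row,
  which are constant anyway.  (A vanishing merged unit has no effect on the function computed,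
  although its row still counts for the rank of the weight matrix.)  The condition
  holds in particular if all \<open>\<nu> j\<close> are nonzero and no two rows
  agree up to sign.
\<close>

definition merged_weight ::
  "'n::finite set \<Rightarrow> nat \<Rightarrow> (nat \<Rightarrow> 'n \<Rightarrow> real) \<Rightarrow> (nat \<Rightarrow> real) \<Rightarrow> real ^ 'n \<Rightarrow> real" where
  "merged_weight S w W \<nu> u =
     (\<Sum>j | j < w \<and> weight_row S W j = u. \<nu> j) - (\<Sum>j | j < w \<and> weight_row S W j = - u. \<nu> j)"

definition no_cancelling_units ::
  "'n::finite set \<Rightarrow> nat \<Rightarrow> (nat \<Rightarrow> 'n \<Rightarrow> real) \<Rightarrow> (nat \<Rightarrow> real) \<Rightarrow> bool" where
  "no_cancelling_units S w W \<nu> \<longleftrightarrow>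
     (\<forall>j<w. weight_row S W j \<noteq> 0 \<longrightarrow> merged_weight S w W \<nu> (weight_row S W j) \<noteq> 0)"

definition score :: "(real ^ 'n::finite \<Rightarrow> real) \<Rightarrow> real ^ 'n \<Rightarrow> real ^ 'n" where
  "score g z = (THE D. GDERIV (\<lambda>x. ln (g x)) z :> D)"

text \<open>
  The environment in which exactly node \<open>i\<close> is intervened is indexed by \<open>i\<close> itself.
\<close>

definition interv_density ::
  "('n::finite \<Rightarrow> real ^ 'n \<Rightarrow> real) \<Rightarrow> ('n \<Rightarrow> real ^ 'n \<Rightarrow> real) \<Rightarrow> 'n \<Rightarrow> real ^ 'n \<Rightarrow> real" where
  "interv_density p q i z = q i z * (\<Prod>j\<in>UNIV - {i}. p j z)"

definition parent_directions :: "('n::finite \<Rightarrow> 'n set) \<Rightarrow> 'n \<Rightarrow> (real ^ 'n) set" where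
  "parent_directions pa i = {c. \<exists>j\<in>insert i (pa i). c $ j \<noteq> 0}"

end

theory Submission
  imports Defs "HOL-Complex_Analysis.Conformal_Mappings"
begin

text \<open>
  Write \<open>a = ln h\<^sub>p\<close>, \<open>b = ln h\<^sub>q\<close> for node \<open>i\<close>, and let \<open>F\<close>, \<open>G\<close> be the derivatives of \<open>f\<^sub>p\<close>, \<open>f\<^sub>q\<close> in
  direction \<open>c\<close>.  As the latent density is positive and the scores are continuous, equality of
  the projected scores holds everywhere, and substituting for \<open>z\<^sub>i\<close> turns it into
  \<open>a'(x) (c\<^sub>i - F z) = b'(x + f\<^sub>p z - f\<^sub>q z) (c\<^sub>i - G z)\<close> for all \<open>x\<close> and \<open>z\<close>.  If \<open>f\<^sub>p - f\<^sub>q\<close> took two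
  values on the open set where \<open>F \<noteq> c\<^sub>i\<close>, then \<open>b (y + t) = k * b y + l\<close> for some \<open>t \<noteq> 0\<close>, which keeps
  \<open>exp b\<close> away from zero on a half-line, so it is not a density.  That set is
  nonempty when \<open>W\<^sub>p\<close> has full rank without cancelling units, because derivatives of sigmoids with distinct rates are linearly
  independent.  Hence \<open>f\<^sub>p - f\<^sub>q\<close> is constant there, and everywhere by analytic continuation along
  lines; so \<open>h\<^sub>p\<close> is a translate of \<open>h\<^sub>q\<close> and the two mechanisms of \<open>i\<close> coincide.  The situation is
  symmetric in \<open>p\<close> and \<open>q\<close>.
\<close>

section \<open>Log densities on the real line\<close>

text \<open>A positive bound \<open>m\<close> on the half-line would make the integral at least
  \<open>n * m\<close> for every natural \<open>n\<close>.\<close>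

lemma integrable_lborel_lower_bound:
  fixes h :: "real \<Rightarrow> real"
  assumes "integrable lborel h" "\<And>x. 0 \<le> h x" "\<And>x. 0 \<le> x \<Longrightarrow> m \<le> h x"
  shows "m \<le> 0"
proof (rule ccontr)
  assume "\<not> m \<le> 0"
  then obtain n :: nat where n: "(LINT x|lborel. h x) < real n * m"
    using reals_Archimedean3[of m] by auto
  have "(LINT x|lborel. indicator {0..real n} x * m) \<le> (LINT x|lborel. h x)"
  proof (rule integral_mono[OF _ assms(1)])
    show "integrable lborel (\<lambda>x. indicator {0..real n} x * m)"
      by (intro integrable_mult_left integrable_real_indicator) auto
  qed (use assms in \<open>auto simp: indicator_def\<close>)
  then show False
    using n by simp
qed

text \<open>Moving right by \<open>t\<close> applies the affine map
  \<open>x \<mapsto> k * x + l\<close> to the values of \<open>a\<close>. Under the condition on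
  \<open>k\<close> and \<open>l\<close> its iterates stay bounded below, uniformly over one period,
  so \<open>exp (a x)\<close> stays away from zero on the right half-line.\<close>

lemma exp_affine_shift_not_integrable_right:
  fixes a :: "real \<Rightarrow> real"
  assumes cont: "continuous_on UNIV a" and "0 < t"
    and shift: "\<And>y. a (y + t) = k * a y + l"
    and k: "k = 1 \<and> 0 \<le> l \<or> k \<noteq> 1 \<and> \<bar>k\<bar> \<le> 1"
  shows "\<not> integrable lborel (\<lambda>x. exp (a x))"
proof
  assume int: "integrable lborel (\<lambda>x. exp (a x))"
  have "\<exists>m. \<forall>n. \<forall>y\<in>{0..t}. m \<le> a (y + real n * t)"
  proof (cases "k = 1")
    case True
    obtain y0 where y0: "\<And>y. y \<in> {0..t} \<Longrightarrow> a y0 \<le> a y"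
      using continuous_attains_inf[of "{0..t}" a] continuous_on_subset[OF cont] \<open>0 < t\<close>
      by (metis atLeastAtMost_iff compact_Icc empty_iff less_eq_real_def subset_UNIV)
    have "a y0 \<le> a (y + real n * t)" if "y \<in> {0..t}" for n y
    proof (induction n)
      case 0
      then show ?case using y0[OF that] by simp
    next
      case (Suc n)
      then show ?case
        using shift[of "y + real n * t"] True k by (simp add: algebra_simps)
    qed
    then show ?thesis by blast
  next
    case False
    \<comment> \<open>\<open>c\<close> is the fixed point of the affine map; the distance of the
      values of \<open>a\<close> to it is multiplied by \<bar>k\<bar> \<le> 1 at each shift.\<close>
    define c where "c = l / (1 - k)"
    have c: "l = c - k * c"
    proof -
      have "(1 - k) * c = l" using False by (simp add: c_def)
      then show ?thesis by (simp add: algebra_simps)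
    qed
    have "\<exists>y0\<in>{0..t}. \<forall>y\<in>{0..t}. \<bar>a y - c\<bar> \<le> \<bar>a y0 - c\<bar>"
      using \<open>0 < t\<close>
      by (intro continuous_attains_sup continuous_intros continuous_on_subset[OF cont]) auto
    then obtain y0 where y0: "\<And>y. y \<in> {0..t} \<Longrightarrow> \<bar>a y - c\<bar> \<le> \<bar>a y0 - c\<bar>"
      by blast
    have "\<bar>a (y + real n * t) - c\<bar> \<le> \<bar>a y0 - c\<bar>" if "y \<in> {0..t}" for n y
    proof (induction n)
      case 0
      then show ?case using y0[OF that] by simp
    next
      case (Suc n)
      have "a (y + real (Suc n) * t) - c = k * (a (y + real n * t) - c)"
        using shift[of "y + real n * t"] by (simp add: c algebra_simps)
      also have "\<bar>\<dots>\<bar> \<le> 1 * \<bar>a (y + real n * t) - c\<bar>"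
        unfolding abs_mult using k False by (intro mult_right_mono) auto
      finally show ?case using Suc by simp
    qed
    then have "c - \<bar>a y0 - c\<bar> \<le> a (y + real n * t)" if "y \<in> {0..t}" for n y
      using that by (simp add: abs_le_iff diff_le_eq le_diff_eq add.commute)
    then show ?thesis by blast
  qed
  then obtain m where m: "\<And>n y. y \<in> {0..t} \<Longrightarrow> m \<le> a (y + real n * t)"
    by blast
  have "m \<le> a y" if "0 \<le> y" for y
  proof -
    \<comment> \<open>The number of whole periods to subtract so that \<open>y\<close> lands in the
      base interval.\<close>
    define n where "n = nat \<lfloor>y / t\<rfloor>"
    have n: "real n = of_int \<lfloor>y / t\<rfloor>"
      using that \<open>0 < t\<close> by (simp add: n_def)
    have "real n \<le> y / t" "y / t \<le> real n + 1"
      unfolding n by linarith+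
    then have "y - real n * t \<in> {0..t}"
      using \<open>0 < t\<close> by (simp add: field_simps)
    from m[OF this, of n] show ?thesis by simp
  qed
  then have "exp m \<le> 0"
    by (intro integrable_lborel_lower_bound[OF int]) auto
  then show False
    using exp_gt_zero[of m] by linarith
qed

lemma exp_affine_shift_not_integrable:
  fixes a :: "real \<Rightarrow> real"
  assumes cont: "continuous_on UNIV a" and "t \<noteq> 0"
    and shift: "\<And>y. a (y + t) = k * a y + l"
  shows "\<not> integrable lborel (\<lambda>x. exp (a x))"
proof
  assume int: "integrable lborel (\<lambda>x. exp (a x))"
  have pos: False if "continuous_on UNIV a" "0 < t" "integrable lborel (\<lambda>x. exp (a x))"
    "\<And>y. a (y + t) = k * a y + l" for a :: "real \<Rightarrow> real" and t k l
  proof (cases "k = 1 \<and> 0 \<le> l \<or> k \<noteq> 1 \<and> \<bar>k\<bar> \<le> 1")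
    case True
    then show False
      using exp_affine_shift_not_integrable_right that by metis
  next
    case False
    then have "k \<noteq> 0" by auto
    \<comment> \<open>Here either k = 1 and l < 0, or \<bar>k\<bar> > 1. Reflecting the line inverts
      the affine map, and the inverse satisfies the condition of the one-sided lemma.\<close>
    have "a (- (y + t)) = inverse k * a (- y) + - l / k" for y
    proof -
      have "a (- y) = k * a (- (y + t)) + l"
        using that(4)[of "- (y + t)"] by simp
      then show ?thesis
        using \<open>k \<noteq> 0\<close> by (simp add: field_simps)
    qed
    moreover have "continuous_on UNIV (\<lambda>x. a (- x))"
      by (rule continuous_on_compose2[OF that(1)]) (auto intro!: continuous_intros)
    moreover have "inverse k = 1 \<and> 0 \<le> - l / k \<or> inverse k \<noteq> 1 \<and> \<bar>inverse k\<bar> \<le> 1"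
      using False \<open>k \<noteq> 0\<close> by (auto simp: abs_inverse inverse_le_1_iff)
    ultimately have "\<not> integrable lborel (\<lambda>x. exp (a (- x)))"
      using exp_affine_shift_not_integrable_right[of "\<lambda>x. a (- x)" t "inverse k" "- l / k"] \<open>0 < t\<close>
      by auto
    then show False
      using lborel_integrable_real_affine[OF that(3), of "-1" 0] by simp
  qed
  show False
  proof (cases "0 < t")
    case True
    then show False using pos[OF cont _ int shift] by simp
  next
    case False
    have "continuous_on UNIV (\<lambda>x. a (- x))"
      by (rule continuous_on_compose2[OF cont]) (auto intro!: continuous_intros)
    moreover have "integrable lborel (\<lambda>x. exp (a (- x)))"
      using lborel_integrable_real_affine[OF int, of "-1" 0] by simp
    moreover have "a (- (y + - t)) = k * a (- y) + l" for y
      using shift[of "- y"] by simp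
    ultimately show False
      using pos[of "\<lambda>x. a (- x)" "- t"] False \<open>t \<noteq> 0\<close> by auto
  qed
qed

lemma diff_const_if_same_derivative:
  fixes f g :: "real \<Rightarrow> real"
  assumes "\<And>x. (f has_real_derivative D x) (at x)" "\<And>x. (g has_real_derivative D x) (at x)"
  obtains K where "\<And>x. f x = g x + K"
proof -
  have "((\<lambda>x. f x - g x) has_real_derivative 0) (at x)" for x
    using DERIV_diff[OF assms] by simp
  then have "f x - g x = f 0 - g 0" for x
    using DERIV_isconst_all[of "\<lambda>x. f x - g x" x 0] by auto
  then show thesis
    by (intro that[of "f 0 - g 0"]) (simp add: algebra_simps)
qed

text \<open>Eliminating \<open>a'\<close> between the two relations gives
  \<open>b' (y + (d2 - d1)) = k * b' y\<close>. Integration turns this into an affine shift equation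
  for \<open>b\<close>, which is incompatible with integrability of \<open>exp (b x)\<close> unless
  the shift is zero.\<close>

lemma scaled_shift_unique:
  fixes a b :: "real \<Rightarrow> real"
  assumes a: "\<And>x. (a has_real_derivative a' x) (at x)" "integrable lborel (\<lambda>x. exp (a x))"
    and b: "\<And>x. (b has_real_derivative b' x) (at x)" "integrable lborel (\<lambda>x. exp (b x))"
    and 1: "\<And>x. a' x * g1 = b' (x + d1) * h1" "g1 \<noteq> 0"
    and 2: "\<And>x. a' x * g2 = b' (x + d2) * h2" "g2 \<noteq> 0"
  shows "d1 = d2"
proof (rule ccontr)
  assume "d1 \<noteq> d2"
  \<comment> \<open>A constant \<open>a\<close> would make \<open>exp (a x)\<close> a positive
    constant, which is not integrable. Hence \<open>h2\<close> is nonzero and can be divided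
    by.\<close>
  have "\<exists>x. a' x \<noteq> 0"
  proof (rule ccontr)
    assume "\<nexists>x. a' x \<noteq> 0"
    then have const: "a x = a 0" for x
      using a(1) DERIV_isconst_all[of a x 0] by auto
    have "exp (a 0) \<le> 0"
      by (rule integrable_lborel_lower_bound[OF a(2)]) (use const in \<open>metis exp_ge_zero order_refl\<close>)+
    then show False
      using exp_gt_zero[of "a 0"] by linarith
  qed
  then have h: "h2 \<noteq> 0"
    using 2 by (metis mult_eq_0_iff)
  define k where "k = h1 * g2 / (g1 * h2)"
  have k: "b' (y + (d2 - d1)) = k * b' y" for y
  proof -
    have "b' (y + (d2 - d1)) * h2 = a' (y - d1) * g2"
      using 2(1)[of "y - d1"] by (simp add: algebra_simps)
    moreover have "a' (y - d1) * g1 = b' y * h1"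
      using 1(1)[of "y - d1"] by simp
    ultimately show ?thesis
      using h 1(2) by (simp add: k_def field_simps)
  qed
  have "((\<lambda>y. b (y + (d2 - d1))) has_real_derivative k * b' y) (at y)" for y
    using DERIV_shift[of b "k * b' y" y "d2 - d1"] b(1)[of "y + (d2 - d1)"] k by simp
  moreover have "((\<lambda>y. k * b y) has_real_derivative k * b' y) (at y)" for y
    by (rule DERIV_cmult[OF b(1)])
  ultimately obtain l where "\<And>y. b (y + (d2 - d1)) = k * b y + l"
    by (rule diff_const_if_same_derivative) blast
  moreover have "continuous_on UNIV b"
    using b(1) by (meson DERIV_continuous continuous_at_imp_continuous_on)
  ultimately show False
    using exp_affine_shift_not_integrable[of b "d2 - d1" k l] b(2) \<open>d1 \<noteq> d2\<close> by auto
qed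

text \<open>Normalization fixes the constant of integration.\<close>

lemma log_pdf_eq_if_same_derivative:
  fixes a b :: "real \<Rightarrow> real"
  assumes "\<And>x. (a has_real_derivative D x) (at x)" "\<And>x. (b has_real_derivative D x) (at x)"
    and "(LINT x|lborel. exp (a x)) = 1" "(LINT x|lborel. exp (b x)) = 1"
  shows "a x = b x"
proof -
  obtain K where K: "\<And>x. a x = b x + K"
    using diff_const_if_same_derivative[OF assms(1,2)] by blast
  have "exp K = 1"
    using assms(3,4) by (simp add: K exp_add)
  then show ?thesis using K by simp
qed

section \<open>Two-layer sigmoid networks\<close>

text \<open>Move the vector found for \<open>A\<close> in the direction of the new element
  \<open>a\<close>: each inner product is affine in the step \<open>s\<close> and vanishes for at
  most one \<open>s\<close>. This provides a generic line on which to compare hidden units.\<close>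

lemma exists_nonorthogonal_to_finite:
  fixes A :: "'a::real_inner set"
  assumes "finite A" "0 \<notin> A"
  shows "\<exists>v. \<forall>a\<in>A. a \<bullet> v \<noteq> 0"
  using assms
proof (induction A)
  case (insert a A)
  then obtain v where v: "\<And>b. b \<in> A \<Longrightarrow> b \<bullet> v \<noteq> 0"
    by auto
  have "finite {s. b \<bullet> v + s * (b \<bullet> a) = 0}" if "b \<in> insert a A" for b
  proof (cases "b \<bullet> a = 0")
    case True
    then show ?thesis using that v insert by auto
  next
    case False
    then have "{s. b \<bullet> v + s * (b \<bullet> a) = 0} \<subseteq> {- (b \<bullet> v) / (b \<bullet> a)}"
      by (auto simp: field_simps)
    then show ?thesis using finite_subset by blast
  qed
  then have "finite (\<Union>b\<in>insert a A. {s. b \<bullet> v + s * (b \<bullet> a) = 0})"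
    using insert by blast
  then obtain s where "s \<notin> (\<Union>b\<in>insert a A. {s. b \<bullet> v + s * (b \<bullet> a) = 0})"
    using ex_new_if_finite[OF infinite_UNIV_char_0] by blast
  then show ?case
    by (intro exI[of _ "v + s *\<^sub>R a"]) (auto simp: inner_add_right)
qed simp

section \<open>The sigmoid: derivative, independence of rescalings, analytic continuation\<close>

definition sigmoid_deriv :: "real \<Rightarrow> real" where
  "sigmoid_deriv x = exp (- x) / (1 + exp (- x))\<^sup>2"

lemma one_plus_exp_neq_0 [simp]: "1 + exp (x::real) \<noteq> 0"
  using exp_gt_zero[of x] by linarith

lemma has_real_derivative_sigmoid:
  "(sigmoid has_real_derivative sigmoid_deriv x) (at x)"
  unfolding sigmoid_def[abs_def] sigmoid_deriv_def
  by (auto intro!: derivative_eq_intros simp: power2_eq_square)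

text \<open>The form \<open>1 / ((1 + exp y) * (1 + exp (- y)))\<close> is symmetric in
  \<open>y\<close>. Evenness allows rates to be replaced by their absolute values.\<close>

lemma sigmoid_deriv_abs: "sigmoid_deriv \<bar>x\<bar> = sigmoid_deriv x"
proof -
  have eq: "sigmoid_deriv y = 1 / ((1 + exp y) * (1 + exp (- y)))" for y
  proof -
    have "exp (- y) * ((1 + exp y) * (1 + exp (- y))) = (1 + exp (- y))\<^sup>2"
      by (simp add: power2_eq_square algebra_simps flip: exp_add)
    then show ?thesis
      unfolding sigmoid_deriv_def by (simp add: frac_eq_eq)
  qed
  show ?thesis
    by (cases "x \<ge> 0") (auto simp: eq mult.commute)
qed

text \<open>The product is \<open>exp (- (c - b) * s)\<close> over a denominator that tends to 1 if
  c > 0. The value 1/4 in the remaining case is \<open>sigmoid_deriv 0\<close>.\<close>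

lemma sigmoid_deriv_scaled_tendsto:
  assumes "0 \<le> b" "b \<le> c"
  shows "((\<lambda>s. exp (b * s) * sigmoid_deriv (c * s)) \<longlongrightarrow>
           (if b = c then (if b = 0 then 1 / 4 else 1) else 0)) at_top"
proof (cases "b = c \<and> b = 0")
  case True
  then show ?thesis by (auto simp: sigmoid_deriv_def)
next
  case False
  then have "0 < c" using assms by auto
  have eq: "exp (b * s) * sigmoid_deriv (c * s) = exp (- (c - b) * s) / (1 + exp (- c * s))\<^sup>2" for s
    by (simp add: sigmoid_deriv_def algebra_simps flip: exp_add)
  have decay: "((\<lambda>s. exp (- d * s)) \<longlongrightarrow> 0) at_top" if "0 < d" for d :: real
  proof -
    have "filterlim (\<lambda>s. - d * s) at_bot at_top"
      using that filterlim_tendsto_neg_mult_at_bot[OF tendsto_const, of "- d" "\<lambda>s. s" at_top]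
      by (simp add: filterlim_ident)
    then show ?thesis by (rule filterlim_compose[OF exp_at_bot])
  qed
  have den: "((\<lambda>s. (1 + exp (- c * s))\<^sup>2) \<longlongrightarrow> (1 + 0)\<^sup>2) at_top"
    by (intro tendsto_intros decay \<open>0 < c\<close>)
  show ?thesis
  proof (cases "b = c")
    case True
    have "((\<lambda>s. 1 / (1 + exp (- c * s))\<^sup>2) \<longlongrightarrow> 1 / (1 + 0)\<^sup>2) at_top"
      by (intro tendsto_intros den) auto
    then show ?thesis using True \<open>0 < c\<close> unfolding eq by simp
  next
    case False
    then have "0 < c - b" using assms by simp
    have "((\<lambda>s. exp (- (c - b) * s) / (1 + exp (- c * s))\<^sup>2) \<longlongrightarrow> 0 / (1 + 0)\<^sup>2) at_top"
      by (intro tendsto_divide den decay \<open>0 < c - b\<close>) auto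
    then show ?thesis using False unfolding eq by simp
  qed
qed

text \<open>The slowest decaying term dominates at infinity, so its coefficient vanishes.\<close>

lemma sigmoid_deriv_linear_independent:
  assumes "finite A" "\<And>b. b \<in> A \<Longrightarrow> 0 \<le> b"
    and "\<And>s. (\<Sum>b\<in>A. B b * sigmoid_deriv (b * s)) = 0"
    and "b \<in> A"
  shows "B b = 0"
  using assms
proof (induction A arbitrary: b rule: finite_linorder_min_induct)
  case (insert m A)
  \<comment> \<open>The induction adds elements below all earlier ones, so \<open>m\<close> is the
    slowest rate; after scaling by \<open>exp (m * s)\<close> only its term survives in the
    limit.\<close>
  have "((\<lambda>s. \<Sum>b\<in>insert m A. B b * (exp (m * s) * sigmoid_deriv (b * s))) \<longlongrightarrow>
      (\<Sum>b\<in>insert m A. B b * (if m = b then (if m = 0 then 1 / 4 else 1) else 0))) at_top"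
    using insert by (intro tendsto_sum tendsto_mult tendsto_const sigmoid_deriv_scaled_tendsto) auto
  moreover have "(\<Sum>b\<in>insert m A. B b * (exp (m * s) * sigmoid_deriv (b * s))) = 0" for s
  proof -
    have "(\<Sum>b\<in>insert m A. B b * (exp (m * s) * sigmoid_deriv (b * s))) =
        exp (m * s) * (\<Sum>b\<in>insert m A. B b * sigmoid_deriv (b * s))"
      unfolding sum_distrib_left by (simp only: mult.left_commute)
    then show ?thesis using insert.prems(2) by simp
  qed
  ultimately have "((\<lambda>s::real. 0) \<longlongrightarrow>
      (\<Sum>b\<in>insert m A. B b * (if m = b then (if m = 0 then 1 / 4 else 1) else 0))) at_top"
    by simp
  then have "(\<Sum>b\<in>insert m A. B b * (if m = b then (if m = 0 then 1 / 4 else 1) else 0)) = 0"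
    by (simp only: tendsto_const_iff[OF trivial_limit_at_top_linorder])
  moreover have "(\<Sum>b\<in>insert m A. B b * (if m = b then (if m = 0 then 1 / 4 else 1) else 0)) =
      (\<Sum>b\<in>insert m A. if m = b then B b * (if m = 0 then 1 / 4 else 1) else 0)"
    by (rule sum.cong) auto
  ultimately have m: "B m = 0"
    using \<open>finite A\<close> by (simp add: sum.delta split: if_splits)
  have "m \<notin> A" using insert.hyps(2) by auto
  have "(\<Sum>b\<in>A. B b * sigmoid_deriv (b * s)) = 0" for s
    using insert.prems(2)[of s] \<open>finite A\<close> \<open>m \<notin> A\<close> m by simp
  then show ?case
    using insert.IH[of b] insert.prems(1,3) m by auto
qed simp

text \<open>The zeros of \<open>1 + exp z\<close> are the odd multiples of
  \<open>\<i> * pi\<close>.\<close>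

lemma one_plus_exp_neq_0_if_small_Im:
  assumes "\<bar>Im z\<bar> < pi"
  shows "1 + exp z \<noteq> 0"
proof
  assume "1 + exp z = 0"
  then have "exp z = exp (\<i> * pi)"
    by (simp add: eq_neg_iff_add_eq_0 add.commute)
  then obtain n :: int where "Im z = pi + 2 * n * pi"
    unfolding exp_eq by (auto simp: algebra_simps)
  then have "Im z = real_of_int (1 + 2 * n) * pi"
    by (simp add: algebra_simps)
  then have "\<bar>real_of_int (1 + 2 * n)\<bar> * pi < 1 * pi"
    using assms by (simp only: abs_mult abs_of_pos[OF pi_gt_zero] mult_1)
  then have "\<bar>real_of_int (1 + 2 * n)\<bar> < 1"
    by (simp only: mult_less_cancel_right_pos[OF pi_gt_zero])
  then have "\<bar>1 + 2 * n\<bar> < 1"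
    by (simp only: of_int_abs[symmetric] of_int_less_1_iff)
  then show False by presburger
qed

text \<open>Both sums extend holomorphically to a strip around the real axis.\<close>

lemma sigmoid_sums_diff_const:
  fixes J :: "'a set" and K :: "'b set"
    and \<alpha> \<beta> \<gamma> :: "'a \<Rightarrow> real" and \<alpha>' \<beta>' \<gamma>' :: "'b \<Rightarrow> real"
  defines "F s \<equiv> (\<Sum>j\<in>J. \<beta> j * sigmoid (\<alpha> j * s + \<gamma> j)) -
                 (\<Sum>j\<in>K. \<beta>' j * sigmoid (\<alpha>' j * s + \<gamma>' j))"
  assumes fin: "finite J" "finite K" and "0 < \<epsilon>" and eq: "\<And>s. \<bar>s\<bar> < \<epsilon> \<Longrightarrow> F s = C"
  shows "F s = C"
proof -
  \<comment> \<open>\<open>T\<close> is positive and bounds every rate, so on the strip \<bar>Im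
    z\<bar> < pi / T all arguments have imaginary part below pi in absolute value and avoid the
    poles.\<close>
  define T where "T = 1 + (\<Sum>j\<in>J. \<bar>\<alpha> j\<bar>) + (\<Sum>j\<in>K. \<bar>\<alpha>' j\<bar>)"
  have nonneg: "0 \<le> (\<Sum>j\<in>J. \<bar>\<alpha> j\<bar>)" "0 \<le> (\<Sum>j\<in>K. \<bar>\<alpha>' j\<bar>)"
    by (auto intro: sum_nonneg)
  then have "0 < T" unfolding T_def by linarith
  define S where "S = {z. - (pi / T) < Im z} \<inter> {z. Im z < pi / T}"
  have S: "open S" "connected S"
    unfolding S_def using open_halfspace_Im_gt open_halfspace_Im_lt
    by (auto intro!: convex_connected convex_Int convex_halfspace_Im_gt convex_halfspace_Im_lt)
  have neq: "1 + exp (- (complex_of_real a * z + complex_of_real g)) \<noteq> 0"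
    if "z \<in> S" "\<bar>a\<bar> \<le> T" for a g z
  proof (rule one_plus_exp_neq_0_if_small_Im)
    have "\<bar>a\<bar> * \<bar>Im z\<bar> \<le> T * \<bar>Im z\<bar>"
      using that by (intro mult_right_mono) auto
    also have "\<dots> < T * (pi / T)"
      using that \<open>0 < T\<close> by (intro mult_strict_left_mono) (auto simp: S_def)
    finally show "\<bar>Im (- (complex_of_real a * z + complex_of_real g))\<bar> < pi"
      using \<open>0 < T\<close> by (simp add: abs_mult)
  qed
  have aT: "\<bar>\<alpha> j\<bar> \<le> T" if "j \<in> J" for j
    using member_le_sum[of _ _ "\<lambda>j. \<bar>\<alpha> j\<bar>", OF that _ fin(1)] nonneg
    unfolding T_def by linarith
  have aT': "\<bar>\<alpha>' j\<bar> \<le> T" if "j \<in> K" for j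
    using member_le_sum[of _ _ "\<lambda>j. \<bar>\<alpha>' j\<bar>", OF that _ fin(2)] nonneg
    unfolding T_def by linarith
  define f where "f z = (\<Sum>j\<in>J. complex_of_real (\<beta> j) * (1 / (1 + exp (- (\<alpha> j * z + \<gamma> j))))) -
      (\<Sum>j\<in>K. complex_of_real (\<beta>' j) * (1 / (1 + exp (- (\<alpha>' j * z + \<gamma>' j)))))"
    for z :: complex
  have f: "f (of_real x) = of_real (F x)" for x
    by (simp add: f_def F_def sigmoid_def flip: exp_of_real)
  have "f holomorphic_on S"
    unfolding f_def by (intro holomorphic_intros neq aT aT')
  then have hol: "(\<lambda>z. f z - of_real C) holomorphic_on S"
    by (intro holomorphic_intros)
  have "0 \<in> S" "of_real s \<in> S"
    using \<open>0 < T\<close> by (auto simp: S_def)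
  define U where "U = complex_of_real ` {0<..<\<epsilon>}"
  have "(0::complex) islimpt U"
  proof -
    have "\<exists>x\<in>U. x \<noteq> 0 \<and> dist x 0 < e" if "0 < e" for e
      using that \<open>0 < \<epsilon>\<close>
      unfolding U_def by (intro bexI[OF _ imageI[of "min e \<epsilon> / 2"]]) auto
    then show ?thesis by (simp add: islimpt_approachable)
  qed
  moreover have "U \<subseteq> S"
    using \<open>0 < T\<close> by (auto simp: U_def S_def)
  moreover have "f z - of_real C = 0" if "z \<in> U" for z
    using that eq by (auto simp: U_def f)
  ultimately have "f (of_real s) - of_real C = 0"
    using analytic_continuation[OF hol S _ \<open>0 \<in> S\<close> _ _ \<open>of_real s \<in> S\<close>] by blast
  then show ?thesis by (simp add: f)
qed

section \<open>Networks through their weight rows: derivatives, rank and nonconstancy\<close>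

lemma two_layer_eq_weight_row:
  "two_layer S w W \<nu> \<nu>0 z = (\<Sum>j<w. \<nu> j * sigmoid (weight_row S W j \<bullet> z)) + \<nu>0"
proof -
  have "(\<Sum>k\<in>S. W j k * z $ k) = weight_row S W j \<bullet> z" for j
    by (simp add: weight_row_def inner_vec_def if_distrib[of "\<lambda>x. x * _"] sum.If_cases cong: if_cong)
  then show ?thesis by (simp add: two_layer_def)
qed

lemma weight_row_inner_add_axis:
  assumes "i \<notin> S"
  shows "weight_row S W j \<bullet> (z + t *\<^sub>R axis i 1) = weight_row S W j \<bullet> z"
proof -
  have "weight_row S W j \<bullet> axis i 1 = 0"
    using assms by (simp add: inner_axis weight_row_def)
  then show ?thesis
    by (simp add: inner_add_right)
qed

text \<open>Coordinate \<open>i\<close> is not an input of the network, so it can be changed freely;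
  this is what permits substituting for it in the score equation.\<close>

lemma two_layer_add_axis:
  assumes "i \<notin> S"
  shows "two_layer S w W \<nu> \<nu>0 (z + t *\<^sub>R axis i 1) = two_layer S w W \<nu> \<nu>0 z"
  by (simp add: two_layer_eq_weight_row weight_row_inner_add_axis assms)

definition two_layer_deriv ::
  "'n::finite set \<Rightarrow> nat \<Rightarrow> (nat \<Rightarrow> 'n \<Rightarrow> real) \<Rightarrow> (nat \<Rightarrow> real) \<Rightarrow> real ^ 'n \<Rightarrow> real ^ 'n \<Rightarrow> real" where
  "two_layer_deriv S w W \<nu> c z =
     (\<Sum>j<w. \<nu> j * (weight_row S W j \<bullet> c) * sigmoid_deriv (weight_row S W j \<bullet> z))"

lemma two_layer_deriv_add_axis:
  assumes "i \<notin> S"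
  shows "two_layer_deriv S w W \<nu> c (z + t *\<^sub>R axis i 1) = two_layer_deriv S w W \<nu> c z"
  by (simp add: two_layer_deriv_def weight_row_inner_add_axis assms)

lemma continuous_on_two_layer_deriv: "continuous_on A (two_layer_deriv S w W \<nu> c)"
  unfolding two_layer_deriv_def[abs_def] sigmoid_deriv_def
  by (intro continuous_intros ballI) simp

lemma has_real_derivative_two_layer:
  "((\<lambda>t. two_layer S w W \<nu> \<nu>0 (z + t *\<^sub>R c)) has_real_derivative two_layer_deriv S w W \<nu> c z) (at 0)"
proof -
  have "((\<lambda>t. sigmoid (u \<bullet> z + t * (u \<bullet> c))) has_real_derivative
      sigmoid_deriv (u \<bullet> z) * (u \<bullet> c)) (at 0)" for u
    by (rule DERIV_chain2[where f = sigmoid and x = 0])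
      (auto intro!: derivative_eq_intros has_real_derivative_sigmoid)
  note this[derivative_intros]
  show ?thesis
    unfolding two_layer_eq_weight_row two_layer_deriv_def inner_add_right inner_scaleR_right
    by (auto intro!: derivative_eq_intros sum.cong simp: mult_ac)
qed

text \<open>Rows of full rank span the coordinate subspace belonging to \<open>S\<close>. If all
  were orthogonal to \<open>c\<close>, the projection of \<open>c\<close> to that subspace would be
  orthogonal to itself.\<close>

lemma weight_row_not_orthogonal:
  assumes "weight_rank S w W = card S" "j \<in> S" "c $ j \<noteq> 0"
  shows "\<exists>l<w. weight_row S W l \<bullet> c \<noteq> 0"
proof (rule ccontr)
  assume "\<not> ?thesis"
  then have orth: "weight_row S W l \<bullet> c = 0" if "l < w" for l
    using that by blast
  define V where "V = {x::real^'a. \<forall>k\<in>Basis. k \<notin> (\<lambda>k. axis k 1) ` S \<longrightarrow> x \<bullet> k = 0}"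
  have V: "x \<in> V \<longleftrightarrow> (\<forall>k. k \<notin> S \<longrightarrow> x $ k = 0)" for x
    by (auto simp: V_def Basis_vec_def inner_axis axis_eq_axis)
  have "dim V = card ((\<lambda>k. axis k (1::real)) ` S)"
    unfolding V_def by (rule dim_substandard) (auto simp: axis_in_Basis_iff)
  also have "\<dots> = card S"
    by (intro card_image) (auto simp: inj_on_def axis_eq_axis)
  finally have dimV: "dim V = card S" .
  let ?R = "weight_row S W ` {..<w}"
  have "?R \<subseteq> V"
    by (auto simp: V weight_row_def)
  moreover have V_subspace: "subspace V"
    unfolding V_def by (rule subspace_substandard)
  ultimately have "span ?R \<subseteq> V"
    by (rule span_minimal)
  moreover have "dim V \<le> dim (span ?R)"
    using dimV assms(1) by (simp add: weight_rank_def dim_span)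
  ultimately have "span ?R = V"
    by (rule subspace_dim_equal[OF subspace_span V_subspace])
  \<comment> \<open>The projection of \<open>c\<close> to \<open>V\<close>; it has the same inner
    products with the rows as \<open>c\<close>.\<close>
  define c' where "c' = (\<chi> k. if k \<in> S then c $ k else 0)"
  have "c' \<in> span ?R"
    unfolding \<open>span ?R = V\<close> by (simp add: V c'_def)
  moreover have "orthogonal c' (weight_row S W l)" if "l < w" for l
  proof -
    have "c' \<bullet> weight_row S W l = weight_row S W l \<bullet> c"
      unfolding inner_vec_def by (rule sum.cong) (auto simp: c'_def weight_row_def)
    then show ?thesis using orth[OF that] by (simp add: orthogonal_def)
  qed
  ultimately have "orthogonal c' c'"
    using orthogonal_to_span[of c' ?R c'] by blast
  then have "c' $ j = 0"
    by (simp add: orthogonal_def)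
  then show False
    using assms by (simp add: c'_def)
qed

text \<open>On a generic line through the origin the derivative is a combination of
  \<open>sigmoid_deriv\<close> at distinct rates, one for each class of rows equal up to sign. If it
  is constant, independence kills every grouped coefficient, first forcing \<open>k = 0\<close> and
  then contradicting the merged weight of a row not orthogonal to \<open>c\<close>.\<close>

lemma two_layer_deriv_not_constant:
  assumes rank: "weight_rank S w W = card S" and nc: "no_cancelling_units S w W \<nu>"
    and k: "k \<noteq> 0 \<or> (\<exists>j\<in>S. c $ j \<noteq> 0)"
  shows "\<exists>z. two_layer_deriv S w W \<nu> c z \<noteq> k"
proof (rule ccontr)
  assume "\<nexists>z. two_layer_deriv S w W \<nu> c z \<noteq> k"
  then have const: "two_layer_deriv S w W \<nu> c z = k" for z
    by blast
  define R where "R = weight_row S W"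
  \<comment> \<open>A direction \<open>v\<close> not orthogonal to the nonzero rows, sums and
    differences separates rows up to sign by \<bar>R j \<bullet> v\<bar>.\<close>
  define D where "D = (R ` {..<w} \<union> (\<lambda>(j, l). R j + R l) ` ({..<w} \<times> {..<w}) \<union>
      (\<lambda>(j, l). R j - R l) ` ({..<w} \<times> {..<w})) - {0}"
  have "finite D" "0 \<notin> D"
    by (auto simp: D_def)
  then obtain v where v: "\<And>d. d \<in> D \<Longrightarrow> d \<bullet> v \<noteq> 0"
    using exists_nonorthogonal_to_finite by metis
  have v0: "R j = 0" if "j < w" "R j \<bullet> v = 0" for j
    using v[of "R j"] that by (auto simp: D_def)
  have v1: "R j = R l \<or> R j = - R l" if "j < w" "l < w" "\<bar>R j \<bullet> v\<bar> = \<bar>R l \<bullet> v\<bar>" for j l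
  proof (rule ccontr)
    assume *: "\<not> ?thesis"
    then have "R j + R l \<in> D" "R j - R l \<in> D"
      using that by (auto simp: D_def add_eq_0_iff)
    from v[OF this(1)] v[OF this(2)] show False
      using that(3) by (auto simp: inner_add_left inner_diff_left abs_eq_iff)
  qed
  define \<beta> where "\<beta> j = \<nu> j * (R j \<bullet> c)" for j
  define A where "A = insert 0 ((\<lambda>j. \<bar>R j \<bullet> v\<bar>) ` {..<w})"
  \<comment> \<open>The constant \<open>k\<close> is absorbed at rate 0, as
    \<open>4 * k * sigmoid_deriv 0\<close>; hence 0 is put into \<open>A\<close>.\<close>
  define B where "B a = (\<Sum>j | j < w \<and> \<bar>R j \<bullet> v\<bar> = a. \<beta> j) - (if a = 0 then 4 * k else 0)" for a
  have sum_eq_0: "(\<Sum>a\<in>A. B a * sigmoid_deriv (a * s)) = 0" for s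
  proof -
    have "(\<Sum>a\<in>A. (\<Sum>j | j \<in> {..<w} \<and> \<bar>R j \<bullet> v\<bar> = a. \<beta> j * sigmoid_deriv (\<bar>R j \<bullet> v\<bar> * s))) =
        (\<Sum>j<w. \<beta> j * sigmoid_deriv (\<bar>R j \<bullet> v\<bar> * s))"
      by (rule sum.group) (auto simp: A_def)
    also have "\<dots> = two_layer_deriv S w W \<nu> c (s *\<^sub>R v)"
      unfolding two_layer_deriv_def
    proof (rule sum.cong)
      fix j
      have "sigmoid_deriv (\<bar>R j \<bullet> v\<bar> * s) = sigmoid_deriv (R j \<bullet> s *\<^sub>R v)"
        using sigmoid_deriv_abs[of "\<bar>R j \<bullet> v\<bar> * s"] sigmoid_deriv_abs[of "R j \<bullet> s *\<^sub>R v"]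
        by (simp add: abs_mult mult.commute)
      then show "\<beta> j * sigmoid_deriv (\<bar>R j \<bullet> v\<bar> * s) =
          \<nu> j * (weight_row S W j \<bullet> c) * sigmoid_deriv (weight_row S W j \<bullet> s *\<^sub>R v)"
        by (simp add: \<beta>_def R_def)
    qed simp
    also have "\<dots> = k" by (rule const)
    also have "(\<Sum>a\<in>A. (\<Sum>j | j \<in> {..<w} \<and> \<bar>R j \<bullet> v\<bar> = a. \<beta> j * sigmoid_deriv (\<bar>R j \<bullet> v\<bar> * s))) =
        (\<Sum>a\<in>A. (\<Sum>j | j < w \<and> \<bar>R j \<bullet> v\<bar> = a. \<beta> j) * sigmoid_deriv (a * s))"
      unfolding sum_distrib_right by (intro sum.cong) auto
    finally have 1: "(\<Sum>a\<in>A. (\<Sum>j | j < w \<and> \<bar>R j \<bullet> v\<bar> = a. \<beta> j) * sigmoid_deriv (a * s)) = k" .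
    have "(\<Sum>a\<in>A. (if a = 0 then 4 * k else 0) * sigmoid_deriv (a * s)) =
        (\<Sum>a\<in>A. if a = 0 then 4 * k * sigmoid_deriv 0 else 0)"
      by (rule sum.cong) auto
    also have "\<dots> = k"
      by (simp add: A_def sigmoid_deriv_def)
    finally show ?thesis
      using 1 by (simp only: B_def left_diff_distrib sum_subtractf diff_self)
  qed
  have B: "B a = 0" if "a \<in> A" for a
    by (rule sigmoid_deriv_linear_independent[OF _ _ sum_eq_0 that]) (auto simp: A_def)
  \<comment> \<open>Only zero rows have rate 0, and they contribute nothing, so \<open>B 0\<close>
    is just \<open>- 4 * k\<close>.\<close>
  have "\<beta> j = 0" if "j < w" "\<bar>R j \<bullet> v\<bar> = 0" for j
    using v0[of j] that by (simp add: \<beta>_def)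
  then have "(\<Sum>j | j < w \<and> \<bar>R j \<bullet> v\<bar> = 0. \<beta> j) = 0"
    by (intro sum.neutral) blast
  then have "k = 0"
    using B[of 0] by (simp add: B_def A_def)
  then obtain l where l: "l < w" "R l \<bullet> c \<noteq> 0"
    using k weight_row_not_orthogonal[OF rank] unfolding R_def by blast
  then have "R l \<noteq> 0" by auto
  have "R l \<noteq> - R l"
  proof
    assume "R l = - R l"
    then have "2 *\<^sub>R R l = 0"
      by (metis scaleR_2 add.right_inverse)
    with \<open>R l \<noteq> 0\<close> show False by simp
  qed
  let ?P = "{j. j < w \<and> R j = R l}" and ?N = "{j. j < w \<and> R j = - R l}"
  have "{j. j < w \<and> \<bar>R j \<bullet> v\<bar> = \<bar>R l \<bullet> v\<bar>} = ?P \<union> ?N"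
    using v1[OF _ l(1)] by auto
  then have "0 = sum \<beta> (?P \<union> ?N)"
    using B[of "\<bar>R l \<bullet> v\<bar>"] l(1) \<open>k = 0\<close> by (simp add: B_def A_def)
  also have "\<dots> = sum \<beta> ?P + sum \<beta> ?N"
    using \<open>R l \<noteq> - R l\<close> by (intro sum.union_disjoint) auto
  \<comment> \<open>On \<open>?N\<close> the factor \<open>R j \<bullet> c\<close> changes sign,
    which produces the difference in \<open>merged_weight\<close>.\<close>
  also have "\<dots> = merged_weight S w W \<nu> (R l) * (R l \<bullet> c)"
    by (simp add: merged_weight_def \<beta>_def R_def left_diff_distrib sum_distrib_right sum_negf)
  finally show False
    using nc l \<open>R l \<noteq> 0\<close> by (simp add: no_cancelling_units_def R_def)
qed

section \<open>Equality of mechanisms\<close>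

lemma GDERIV_along_line:
  assumes "GDERIV g (z + t *\<^sub>R c) :> D"
  shows "((\<lambda>t. g (z + t *\<^sub>R c)) has_real_derivative c \<bullet> D) (at t)"
proof -
  have "((\<lambda>t. z + t *\<^sub>R c) has_derivative (\<lambda>s. s *\<^sub>R c)) (at t)"
    by (auto intro!: derivative_eq_intros)
  from has_derivative_compose[OF this assms[unfolded gderiv_def]]
  show ?thesis
    by (simp add: has_field_derivative_def mult_commute_abs)
qed

text \<open>Restricting \<open>p\<close> to a line parallel to axis \<open>i\<close> recovers
  \<open>h\<close>, as the network is constant there; so \<open>h\<close> inherits positivity and
  differentiability. The last claim computes the derivative of \<open>ln (p z)\<close> along
  \<open>c\<close> in two ways.\<close>

lemma log_noise_derivative:
  fixes p :: "real ^ 'n::finite \<Rightarrow> real"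
  assumes "i \<notin> S" and p: "\<And>z. p z = h (z $ i - two_layer S w W \<nu> \<nu>0 z)"
    and pos: "\<And>z. p z > 0" and D: "\<And>z. GDERIV p z :> D z"
  obtains a' where "\<And>x. h x > 0"
    and "\<And>x. ((\<lambda>x. ln (h x)) has_real_derivative a' x) (at x)"
    and "\<And>z. c \<bullet> D z / p z =
           a' (z $ i - two_layer S w W \<nu> \<nu>0 z) * (c $ i - two_layer_deriv S w W \<nu> c z)"
proof -
  define f where "f = two_layer S w W \<nu> \<nu>0"
  define e where "e = (axis i 1 :: real ^ 'n)"
  have h: "h = (\<lambda>x. p (f 0 *\<^sub>R e + x *\<^sub>R e))"
    using two_layer_add_axis[OF \<open>i \<notin> S\<close>, of w W \<nu> \<nu>0 0]
    by (auto simp: p f_def e_def simp flip: scaleR_add_left)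
  have h_pos: "h x > 0" for x
    by (simp add: h pos)
  define a' where "a' x = (e \<bullet> D (f 0 *\<^sub>R e + x *\<^sub>R e)) / h x" for x
  have a': "((\<lambda>x. ln (h x)) has_real_derivative a' x) (at x)" for x
  proof -
    have "(h has_real_derivative e \<bullet> D (f 0 *\<^sub>R e + x *\<^sub>R e)) (at x)"
      unfolding h by (rule GDERIV_along_line[OF D])
    from DERIV_chain2[OF DERIV_ln_divide[OF h_pos] this] show ?thesis
      by (simp add: a'_def)
  qed
  have "c \<bullet> D z / p z = a' (z $ i - f z) * (c $ i - two_layer_deriv S w W \<nu> c z)" for z
  proof -
    have "((\<lambda>t. p (z + t *\<^sub>R c)) has_real_derivative c \<bullet> D z) (at 0)"
      using GDERIV_along_line[of p z 0 c] D by simp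
    from DERIV_chain2[OF DERIV_ln_divide this] pos[of z]
    have 1: "((\<lambda>t. ln (p (z + t *\<^sub>R c))) has_real_derivative c \<bullet> D z / p z) (at 0)"
      by simp
    have "((\<lambda>t. (z + t *\<^sub>R c) $ i) has_real_derivative c $ i) (at 0)"
      by (auto intro!: derivative_eq_intros)
    then have "((\<lambda>t. (z + t *\<^sub>R c) $ i - f (z + t *\<^sub>R c)) has_real_derivative
        c $ i - two_layer_deriv S w W \<nu> c z) (at 0)"
      unfolding f_def by (intro DERIV_diff has_real_derivative_two_layer)
    from DERIV_chain2[where f = "\<lambda>x. ln (h x)", OF a' this]
    have "((\<lambda>t. ln (p (z + t *\<^sub>R c))) has_real_derivative
        a' (z $ i - f z) * (c $ i - two_layer_deriv S w W \<nu> c z)) (at 0)"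
      by (simp add: p f_def)
    with 1 show ?thesis by (rule DERIV_unique)
  qed
  then show thesis
    using that h_pos a' unfolding f_def by blast
qed

text \<open>Along the line from \<open>z0\<close> to \<open>z\<close> the difference is a difference
  of sigmoid sums in the parameter \<open>s\<close>, up to a constant. It is constant for small
  \<open>s\<close>, hence also at s = 1.\<close>

lemma two_layer_diff_const:
  assumes f: "f = two_layer S w W \<nu> \<nu>0" and g: "g = two_layer S' w' W' \<nu>' \<nu>0'"
    and "open U" "z0 \<in> U" and const: "\<And>z. z \<in> U \<Longrightarrow> f z - g z = f z0 - g z0"
  shows "f z - g z = f z0 - g z0"
proof -
  define d where "d = z - z0"
  have diff: "f (z0 + s *\<^sub>R d) - g (z0 + s *\<^sub>R d) =
      (\<Sum>j<w. \<nu> j * sigmoid ((weight_row S W j \<bullet> d) * s + weight_row S W j \<bullet> z0)) -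
      (\<Sum>j<w'. \<nu>' j * sigmoid ((weight_row S' W' j \<bullet> d) * s + weight_row S' W' j \<bullet> z0)) + (\<nu>0 - \<nu>0')"
    for s
    by (simp add: f g two_layer_eq_weight_row inner_add_right mult.commute[of s] add.commute)
  obtain r where "r > 0" and r: "ball z0 r \<subseteq> U"
    using \<open>open U\<close> \<open>z0 \<in> U\<close> open_contains_ball by blast
  \<comment> \<open>Adding 1 to the norm avoids a zero denominator when
    \<open>z = z0\<close>.\<close>
  define \<epsilon> where "\<epsilon> = r / (1 + norm d)"
  have "0 < 1 + norm d"
    using norm_ge_zero[of d] by linarith
  then have "\<epsilon> > 0"
    using \<open>r > 0\<close> by (simp add: \<epsilon>_def)
  have "(\<Sum>j<w. \<nu> j * sigmoid ((weight_row S W j \<bullet> d) * s + weight_row S W j \<bullet> z0)) -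
      (\<Sum>j<w'. \<nu>' j * sigmoid ((weight_row S' W' j \<bullet> d) * s + weight_row S' W' j \<bullet> z0)) =
      f z0 - g z0 - (\<nu>0 - \<nu>0')" if "\<bar>s\<bar> < \<epsilon>" for s
  proof -
    have "\<bar>s\<bar> * norm d \<le> \<bar>s\<bar> * (1 + norm d)"
      by (intro mult_left_mono) auto
    also have "\<dots> < r"
      using that \<open>0 < 1 + norm d\<close> by (simp add: \<epsilon>_def pos_less_divide_eq)
    finally have "z0 + s *\<^sub>R d \<in> U"
      using r by (intro subsetD[OF r]) (simp add: dist_norm)
    from const[OF this] show ?thesis
      unfolding diff by linarith
  qed
  from sigmoid_sums_diff_const[OF finite_lessThan finite_lessThan \<open>\<epsilon> > 0\<close> this, of 1]
  have "f (z0 + 1 *\<^sub>R d) - g (z0 + 1 *\<^sub>R d) = f z0 - g z0"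
    unfolding diff by simp
  then show ?thesis
    by (simp add: d_def)
qed

text \<open>The rank and cancellation conditions are imposed on the first mechanism only; the other
  case follows by exchanging \<open>p\<close> and \<open>q\<close>.\<close>

lemma mechanisms_eq_if_score_eq:
  fixes p q :: "real ^ 'n::finite \<Rightarrow> real"
  assumes "i \<notin> S"
    and p: "\<And>z. p z = hp (z $ i - two_layer S wp Wp \<nu>p \<nu>p0 z)"
    and q: "\<And>z. q z = hq (z $ i - two_layer S wq Wq \<nu>q \<nu>q0 z)"
    and pos: "\<And>z. p z > 0" "\<And>z. q z > 0"
    and D: "\<And>z. GDERIV p z :> Dp z" "\<And>z. GDERIV q z :> Dq z"
    and pdf: "analytic_pdf hp" "analytic_pdf hq"
    and rank: "weight_rank S wp Wp = card S" and nc: "no_cancelling_units S wp Wp \<nu>p"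
    and c: "\<exists>j\<in>insert i S. c $ j \<noteq> 0"
    and score_eq: "\<And>z. c \<bullet> Dp z / p z = c \<bullet> Dq z / q z"
  shows "p = q"
proof -
  define f g where "f = two_layer S wp Wp \<nu>p \<nu>p0" and "g = two_layer S wq Wq \<nu>q \<nu>q0"
  define F G where "F = two_layer_deriv S wp Wp \<nu>p c" and "G = two_layer_deriv S wq Wq \<nu>q c"
  obtain a' where hp_pos: "\<And>x. hp x > 0"
    and a': "\<And>x. ((\<lambda>x. ln (hp x)) has_real_derivative a' x) (at x)"
    and pD: "\<And>z. c \<bullet> Dp z / p z = a' (z $ i - f z) * (c $ i - F z)"
    using log_noise_derivative[OF \<open>i \<notin> S\<close> p pos(1) D(1)] unfolding f_def F_def by metis
  obtain b' where hq_pos: "\<And>x. hq x > 0"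
    and b': "\<And>x. ((\<lambda>x. ln (hq x)) has_real_derivative b' x) (at x)"
    and qD: "\<And>z. c \<bullet> Dq z / q z = b' (z $ i - g z) * (c $ i - G z)"
    using log_noise_derivative[OF \<open>i \<notin> S\<close> q pos(2) D(2)] unfolding g_def G_def by metis
  have eq: "a' x * (c $ i - F z) = b' (x + (f z - g z)) * (c $ i - G z)" for x z
  proof -
    \<comment> \<open>Replaces coordinate \<open>i\<close> of \<open>z\<close> by
      \<open>x + f z\<close>, so that the noise is \<open>x\<close> under \<open>p\<close> and
      \<open>x + (f z - g z)\<close> under \<open>q\<close>.\<close>
    define y where "y = z + (x + f z - z $ i) *\<^sub>R axis i 1"
    have "f y = f z" "g y = g z" "F y = F z" "G y = G z"
      using \<open>i \<notin> S\<close> unfolding y_def f_def g_def F_def G_def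
      by (simp_all only: two_layer_add_axis two_layer_deriv_add_axis not_False_eq_True)
    moreover have "y $ i = x + f z"
      by (simp add: y_def)
    moreover have "a' (y $ i - f y) * (c $ i - F y) = b' (y $ i - g y) * (c $ i - G y)"
      using score_eq[of y] pD[of y] qD[of y] by simp
    ultimately show ?thesis by (simp add: algebra_simps)
  qed
  \<comment> \<open>Either \<open>c $ i\<close> is nonzero or \<open>c\<close> has a nonzero parent
    coordinate, which is what nonconstancy with value \<open>c $ i\<close> requires.\<close>
  obtain z0 where z0: "F z0 \<noteq> c $ i"
    using two_layer_deriv_not_constant[OF rank nc, of "c $ i" c] c unfolding F_def by blast
  have int: "integrable lborel (\<lambda>x. exp (ln (hp x)))" "integrable lborel (\<lambda>x. exp (ln (hq x)))"
    using pdf hp_pos hq_pos by (simp_all add: analytic_pdf_def)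
  have const: "f z - g z = f z0 - g z0" for z
  proof (rule two_layer_diff_const[OF f_def g_def])
    have "continuous_on UNIV F"
      unfolding F_def by (rule continuous_on_two_layer_deriv)
    then show "open {z. F z \<noteq> c $ i}"
      by (intro open_Collect_neq) auto
    show "f z - g z = f z0 - g z0" if "z \<in> {z. F z \<noteq> c $ i}" for z
    proof (rule scaled_shift_unique[OF a' int(1) b' int(2)])
      show "a' x * (c $ i - F z) = b' (x + (f z - g z)) * (c $ i - G z)" for x
        by (rule eq)
      show "a' x * (c $ i - F z0) = b' (x + (f z0 - g z0)) * (c $ i - G z0)" for x
        by (rule eq)
    qed (use that z0 in auto)
  qed (use z0 in simp)
  \<comment> \<open>Differentiating the constant \<open>f - g\<close> along \<open>c\<close>; the
    nonzero factor \<open>c $ i - F z0\<close> then cancels from \<open>eq\<close>.\<close>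
  have "F z0 = G z0"
  proof -
    have "((\<lambda>t. f (z0 + t *\<^sub>R c) - g (z0 + t *\<^sub>R c)) has_real_derivative F z0 - G z0) (at 0)"
      unfolding f_def g_def F_def G_def by (intro DERIV_diff has_real_derivative_two_layer)
    moreover have "(\<lambda>t. f (z0 + t *\<^sub>R c) - g (z0 + t *\<^sub>R c)) = (\<lambda>t. f z0 - g z0)"
      by (rule ext) (rule const)
    ultimately have "((\<lambda>t. f z0 - g z0) has_real_derivative F z0 - G z0) (at 0)"
      by simp
    from DERIV_unique[OF this DERIV_const] show ?thesis by simp
  qed
  then have a'_eq: "a' x = b' (x + (f z0 - g z0))" for x
    using eq[of x z0] z0 by simp
  have "ln (hp x) = ln (hq (x + (f z0 - g z0)))" for x
  proof (rule log_pdf_eq_if_same_derivative[OF a'])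
    show "((\<lambda>x. ln (hq (x + (f z0 - g z0)))) has_real_derivative a' x) (at x)" for x
      using b'[of "x + (f z0 - g z0)"] unfolding a'_eq by (simp add: DERIV_shift)
    show "(LINT x|lborel. exp (ln (hp x))) = 1"
      using pdf hp_pos by (simp add: analytic_pdf_def)
    have "(LINT x|lborel. hq x) = 1"
      using pdf by (simp add: analytic_pdf_def)
    then show "(LINT x|lborel. exp (ln (hq (x + (f z0 - g z0))))) = 1"
      using lborel_integral_real_affine[of 1 hq "f z0 - g z0"] hq_pos by (simp add: add.commute)
  qed
  then have "hp x = hq (x + (f z0 - g z0))" for x
    using hp_pos hq_pos by (metis ln_inj_iff)
  then have "p z = q z" for z
    using const[of z] unfolding p q f_def[symmetric] g_def[symmetric] by (simp add: algebra_simps)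
  then show ?thesis by blast
qed

section \<open>Scores\<close>

lemma score_eqI:
  fixes g :: "real ^ 'n::finite \<Rightarrow> real"
  assumes "GDERIV (\<lambda>x. ln (g x)) z :> D"
  shows "score g z = D"
  unfolding score_def
proof (rule the_equality)
  show "GDERIV (\<lambda>x. ln (g x)) z :> D" by (rule assms)
  fix D' assume "GDERIV (\<lambda>x. ln (g x)) z :> D'"
  then have "(\<lambda>h. h \<bullet> D') = (\<lambda>h. h \<bullet> D)"
    using assms unfolding gderiv_def by (rule has_derivative_unique)
  then have "(D' - D) \<bullet> D' = (D' - D) \<bullet> D"
    by metis
  then have "(D' - D) \<bullet> (D' - D) = 0"
    by (simp add: inner_diff_right)
  then show "D' = D" by simp
qed

lemma score_prod:
  fixes g :: "'n::finite \<Rightarrow> real ^ 'n \<Rightarrow> real"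
  assumes "\<And>j z. g j z > 0" "\<And>j. GDERIV (g j) z :> D j"
  shows "score (\<lambda>z. \<Prod>j\<in>UNIV. g j z) z = (\<Sum>j\<in>UNIV. (1 / g j z) *\<^sub>R D j)"
proof (rule score_eqI)
  have "GDERIV (\<lambda>z. ln (g j z)) z :> (1 / g j z) *\<^sub>R D j" for j
    by (rule GDERIV_DERIV_compose[OF assms(2) DERIV_ln_divide[OF assms(1)]])
  then have "GDERIV (\<lambda>z. \<Sum>j\<in>UNIV. ln (g j z)) z :> (\<Sum>j\<in>UNIV. (1 / g j z) *\<^sub>R D j)"
    unfolding gderiv_def inner_sum_right by (intro has_derivative_sum)
  moreover have "ln (\<Prod>j\<in>UNIV. g j z) = (\<Sum>j\<in>UNIV. ln (g j z))" for z
    by (rule ln_prod) (auto simp: assms(1) less_imp_neq[symmetric])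
  ultimately show "GDERIV (\<lambda>z. ln (\<Prod>j\<in>UNIV. g j z)) z :> (\<Sum>j\<in>UNIV. (1 / g j z) *\<^sub>R D j)"
    by simp
qed

text \<open>The intervened density is the product with factor \<open>i\<close> replaced, so in the
  difference of log gradients all other factors cancel.\<close>

lemma score_prod_diff_interv:
  fixes p q :: "'n::finite \<Rightarrow> real ^ 'n \<Rightarrow> real"
  assumes pos: "\<And>j z. p j z > 0" "\<And>j z. q j z > 0"
    and D: "\<And>j. GDERIV (p j) z :> Dp j" "\<And>j. GDERIV (q j) z :> Dq j"
  shows "score (\<lambda>z. \<Prod>j\<in>UNIV. p j z) z - score (interv_density p q i) z =
           (1 / p i z) *\<^sub>R Dp i - (1 / q i z) *\<^sub>R Dq i"
proof -
  have "interv_density p q i = (\<lambda>z. \<Prod>j\<in>UNIV. (p(i := q i)) j z)"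
    by (rule ext) (simp add: interv_density_def prod.remove[of UNIV i])
  moreover have "score (\<lambda>z. \<Prod>j\<in>UNIV. (p(i := q i)) j z) z =
      (\<Sum>j\<in>UNIV. (1 / (p(i := q i)) j z) *\<^sub>R (Dp(i := Dq i)) j)"
    using pos D by (intro score_prod) auto
  moreover have "score (\<lambda>z. \<Prod>j\<in>UNIV. p j z) z = (\<Sum>j\<in>UNIV. (1 / p j z) *\<^sub>R Dp j)"
    using pos D by (intro score_prod)
  ultimately show ?thesis
    by (simp add: sum.remove[of UNIV i])
qed

text \<open>Positivity of the density turns almost surely into Lebesgue almost everywhere, and a
  closed set of full Lebesgue measure is the whole space.\<close>

lemma AE_distributed_pos_density_closed:
  fixes Z :: "'a \<Rightarrow> 'b::euclidean_space"
  assumes Z: "distributed M lborel Z (\<lambda>z. ennreal (f z))" and pos: "\<And>z. f z > 0"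
    and C: "closed C" "AE \<omega> in M. Z \<omega> \<in> C"
  shows "z \<in> C"
proof -
  have Z_meas: "Z \<in> measurable M lborel" and C_meas: "C \<in> sets lborel"
    and [measurable]:
      "(\<lambda>z. ennreal (f z)) \<in> borel_measurable lborel"
    and distr: "distr M lborel Z = density lborel (\<lambda>z. ennreal (f z))"
    using Z C(1) by (auto simp: distributed_def)
  have "AE z in distr M lborel Z. z \<in> C"
    using C(2) C_meas by (subst AE_distr_iff[OF Z_meas]) simp_all
  then have "AE z in lborel. z \<in> C"
    unfolding distr by (subst (asm) AE_density) (auto simp: pos)
  then have "AE z in lebesgue. z \<in> C"
    by (rule AE_completion)
  then show ?thesis
    using C(1) mem_closed_if_AE_lebesgue by blast
qed

section \<open>From almost sure equality of projected scores to equal mechanisms\<close>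

theorem lemma5:
  fixes M :: "'a measure"
    and Z :: "'a \<Rightarrow> real ^ 'n::finite"
    and pa :: "'n \<Rightarrow> 'n set"
    and pZ :: "real ^ 'n \<Rightarrow> real"
    and p q :: "'n \<Rightarrow> real ^ 'n \<Rightarrow> real"
    and fp fq :: "'n \<Rightarrow> real ^ 'n \<Rightarrow> real"
    and hp hq :: "'n \<Rightarrow> real \<Rightarrow> real"
    and wp wq :: "'n \<Rightarrow> nat"
    and Wp Wq :: "'n \<Rightarrow> nat \<Rightarrow> 'n \<Rightarrow> real"
    and \<nu>p \<nu>q :: "'n \<Rightarrow> nat \<Rightarrow> real"
    and \<nu>p0 \<nu>q0 :: "'n \<Rightarrow> real"
  assumes "prob_space M"
    and "distributed M lborel Z (\<lambda>z. ennreal (pZ z))"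
    and "\<And>z. pZ z \<noteq> 0"
    and "acyclic_parents pa"
    and "\<And>z. pZ z = (\<Prod>i\<in>UNIV. p i z)"
    and "\<And>i. q i \<noteq> p i"
    and "\<And>i z. p i z > 0" and "\<And>i z. q i z > 0"
    and "\<And>i. cont_differentiable (p i)" and "\<And>i. cont_differentiable (q i)"
    and "\<And>i. analytic_pdf (hp i)" and "\<And>i. analytic_pdf (hq i)"
    and "\<And>i z. p i z = hp i (z $ i - fp i z)"
    and "\<And>i z. q i z = hq i (z $ i - fq i z)"
    and "\<And>i. fp i = two_layer (pa i) (wp i) (Wp i) (\<nu>p i) (\<nu>p0 i)"
    and "\<And>i. fq i = two_layer (pa i) (wq i) (Wq i) (\<nu>q i) (\<nu>q0 i)"
    and "\<And>i. max (weight_rank (pa i) (wp i) (Wp i)) (weight_rank (pa i) (wq i) (Wq i))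
              = card (pa i)"
    and "\<And>i. weight_rank (pa i) (wp i) (Wp i) = card (pa i) \<and>
                no_cancelling_units (pa i) (wp i) (Wp i) (\<nu>p i)
            \<or> weight_rank (pa i) (wq i) (Wq i) = card (pa i) \<and>
                no_cancelling_units (pa i) (wq i) (Wq i) (\<nu>q i)"
  shows "\<forall>i. \<forall>c\<in>parent_directions pa i.
           \<not> (AE \<omega> in M. c \<bullet> score pZ (Z \<omega>) = c \<bullet> score (interv_density p q i) (Z \<omega>))"
proof (intro allI ballI notI)
  fix i c
  assume "c \<in> parent_directions pa i"
    and AE: "AE \<omega> in M. c \<bullet> score pZ (Z \<omega>) = c \<bullet> score (interv_density p q i) (Z \<omega>)"
  then have c: "\<exists>j\<in>insert i (pa i). c $ j \<noteq> 0"
    by (simp add: parent_directions_def)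
  obtain Dp where Dp: "\<And>i z. GDERIV (p i) z :> Dp i z" "\<And>i. continuous_on UNIV (Dp i)"
    using assms(9) unfolding cont_differentiable_def by metis
  obtain Dq where Dq: "\<And>i z. GDERIV (q i) z :> Dq i z" "\<And>i. continuous_on UNIV (Dq i)"
    using assms(10) unfolding cont_differentiable_def by metis
  have cont: "continuous_on UNIV (p i)" "continuous_on UNIV (q i)"
    using Dp(1) Dq(1) unfolding gderiv_def
    by (meson has_derivative_continuous continuous_at_imp_continuous_on)+
  \<comment> \<open>The set where the projected scores agree, in terms of node \<open>i\<close>
    alone; it is closed because the mechanisms are continuously differentiable and positive.\<close>
  define C where "C = {z. c \<bullet> Dp i z / p i z = c \<bullet> Dq i z / q i z}"
  have "pZ = (\<lambda>z. \<Prod>i\<in>UNIV. p i z)"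
    using assms(5) by blast
  then have "score pZ z - score (interv_density p q i) z =
      (1 / p i z) *\<^sub>R Dp i z - (1 / q i z) *\<^sub>R Dq i z" for z
    using score_prod_diff_interv[OF assms(7,8) Dp(1) Dq(1)] by simp
  then have "c \<bullet> (score pZ z - score (interv_density p q i) z) =
      c \<bullet> ((1 / p i z) *\<^sub>R Dp i z - (1 / q i z) *\<^sub>R Dq i z)" for z
    by (rule arg_cong)
  then have diff: "c \<bullet> score pZ z - c \<bullet> score (interv_density p q i) z =
      c \<bullet> Dp i z / p i z - c \<bullet> Dq i z / q i z" for z
    unfolding inner_diff_right by simp
  have "AE \<omega> in M. Z \<omega> \<in> C"
    using AE
  proof eventually_elim
    case (elim \<omega>)
    then show ?case
      using diff[of "Z \<omega>"] by (simp add: C_def)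
  qed
  have "closed C"
    unfolding C_def using assms(7,8)
    by (intro closed_Collect_eq continuous_intros cont Dp(2) Dq(2)) (auto simp: less_imp_neq[symmetric])
  have "pZ z > 0" for z
    using assms(5,7) by (simp add: prod_pos)
  then have "z \<in> C" for z
    by (rule AE_distributed_pos_density_closed[OF assms(2) _ \<open>closed C\<close> \<open>AE \<omega> in M. Z \<omega> \<in> C\<close>])
  then have eq: "c \<bullet> Dp i z / p i z = c \<bullet> Dq i z / q i z" for z
    by (simp add: C_def)
  \<comment> \<open>A node that is its own parent would be a cycle of length one.\<close>
  have i: "i \<notin> pa i"
    using assms(4) unfolding acyclic_parents_def acyclic_def by blast
  note p = assms(13)[of i, unfolded assms(15)] and q = assms(14)[of i, unfolded assms(16)]
  have "p i = q i"
    using assms(18)[of i]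
  proof (elim disjE conjE)
    assume "weight_rank (pa i) (wp i) (Wp i) = card (pa i)"
      "no_cancelling_units (pa i) (wp i) (Wp i) (\<nu>p i)"
    then show ?thesis
      by (rule mechanisms_eq_if_score_eq[OF i p q assms(7,8) Dp(1) Dq(1) assms(11,12) _ _ c eq])
  next
    assume "weight_rank (pa i) (wq i) (Wq i) = card (pa i)"
      "no_cancelling_units (pa i) (wq i) (Wq i) (\<nu>q i)"
    then show ?thesis
      by (rule mechanisms_eq_if_score_eq[OF i q p assms(8,7) Dq(1) Dp(1) assms(12,11) _ _ c eq[symmetric], symmetric])
  qed
  then show False
    using assms(6)[of i] by simp
qed

end
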